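(* Let $f,g:U\subset\mathbb{R}\to\mathbb{R}$ be differentiable with Lipschitz continuous derivatives $f'$ and $g'$ and corresponding Lipschitz constants $\alpha$ (for $f'$) and $\beta$ (for $g'$). Furthermore, let $|f'(x)-g'(x)|\geq\gamma>0$ for all $x$. Then a sequence $x_k$ generated by the iteration that performs two steps, from $x_k$ to $x_{k+1}$ and from $x_{k+1}$ to $x_{k+2}$, via $$f(x_k)+f'(x_k)(x_{k+1}-x_k)=g(x_{k+1})\quad\text{and}\quad g(x_{k+1})+g'(x_{k+1})(x_{k+2}-x_{k+1})=f(x_{k+2})$$ satisfies $$|\Delta x_k|\Big(1-\frac{\beta}{2}|\Delta x_k|\Big)\leq\frac{\alpha}{2\gamma}|\Delta x_{k-1}|^2,$$ $$|\Delta x_{k+1}|\Big(1-\frac{\alpha}{2}|\Delta x_{k+1}|\Big)\leq\frac{\beta}{2\gamma}|\Delta x_k|^2,$$ where $\Delta x_k=x_{k+1}-x_k$.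
   Formalization: The printed factors 1-(β/2)|Δx_k| and 1-(α/2)|Δx_{k+1}| fail for γ<1 and are corrected to 1-(β/(2γ))|Δx_k| and 1-(α/(2γ))|Δx_{k+1}|; U is taken to be an interval, since the claim fails for disconnected U; k is odd, f-tangent steps starting at even indices. *)

theory Defs
  imports "HOL-Analysis.Analysis"
begin

definition step_diff :: "(nat \<Rightarrow> real) \<Rightarrow> nat \<Rightarrow> real"
  where "step_diff x k = x (k + 1) - x k"

text \<open>
  The two kinds of steps alternate: every step starting at an even index follows the
  tangent of \<open>f\<close> until it meets the graph of \<open>g\<close>, every step starting at an
  odd index follows the tangent of \<open>g\<close> until it meets the graph of \<open>f\<close>.
  The arguments \<open>f'\<close> and \<open>g'\<close> stand for the derivatives on \<open>U\<close>.
\<close>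

definition alternating_iteration ::
  "real set \<Rightarrow> (real \<Rightarrow> real) \<Rightarrow> (real \<Rightarrow> real) \<Rightarrow> (real \<Rightarrow> real) \<Rightarrow> (real \<Rightarrow> real) \<Rightarrow> (nat \<Rightarrow> real) \<Rightarrow> bool"
  where "alternating_iteration U f f' g g' x \<longleftrightarrow>
    (\<forall>k. x k \<in> U) \<and>
    (\<forall>k. even k \<longrightarrow>
      f (x k) + f' (x k) * (x (k + 1) - x k) = g (x (k + 1)) \<and>
      g (x (k + 1)) + g' (x (k + 1)) * (x (k + 2) - x (k + 1)) = f (x (k + 2)))"

end

theory Submission
  imports Defs
begin

text \<open>
  Let \<open>h = f - g\<close>. A step along the tangent of \<open>f\<close> (or \<open>g\<close>) ends at a point where \<open>h\<close>
  equals the remainder of the linearisation of \<open>f\<close> (or of \<open>g\<close>, up to sign), which is quadratic in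
  the step length. On the other hand \<open>\<bar>h'\<bar> \<ge> \<gamma>\<close>, so by the mean value theorem \<open>\<gamma>\<close> times a step
  length is at most the sum of the values of \<open>\<bar>h\<bar>\<close> at both ends of the step.
\<close>

text \<open>Along the segment from \<open>a\<close> to \<open>b\<close> the derivative of the
  remainder grows at most linearly, and integrating this bound gives the factor 1/2; the mean value
  theorem alone would only give \<open>L\<close>.\<close>

lemma lipschitz_deriv_remainder_le:
  fixes F F' :: "real \<Rightarrow> real"
  assumes "is_interval U"
    and deriv: "\<And>t. t \<in> U \<Longrightarrow> (F has_real_derivative F' t) (at t within U)"
    and lip: "L-lipschitz_on U F'" and "a \<in> U" "b \<in> U"
  shows "\<bar>F b - F a - F' a * (b - a)\<bar> \<le> L / 2 * \<bar>b - a\<bar>\<^sup>2"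
proof -
  \<comment> \<open>Parametrising by \<open>s\<close> in [0,1] treats \<open>a < b\<close> and
    \<open>b < a\<close> alike. \<open>r 1 - r 0\<close> is the remainder, and \<open>q\<close> is
    the majorant whose derivative dominates that of \<open>r\<close>.\<close>
  define p where "p s = a + s * (b - a)" for s
  define r where "r s = F (p s) - s * (F' a * (b - a))" for s
  define q where "q s = L / 2 * \<bar>b - a\<bar>\<^sup>2 * s\<^sup>2" for s
  have p_in: "p s \<in> U" if "s \<in> {0..1}" for s
  proof -
    have "(1 - s) *\<^sub>R a + s *\<^sub>R b \<in> U"
      using that assms by (intro convexD_alt is_interval_convex) auto
    then show ?thesis by (simp add: p_def algebra_simps)
  qed
  have r_deriv: "(r has_real_derivative (F' (p s) - F' a) * (b - a)) (at s within {0..1})"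
    if "s \<in> {0..1}" for s
  proof -
    \<comment> \<open>At an endpoint of \<open>U\<close> only a one-sided derivative is given, so
      the chain rule is applied within the image of the segment.\<close>
    have "(F has_real_derivative F' (p s)) (at (p s) within p ` {0..1})"
      using deriv[OF p_in[OF that]] by (rule DERIV_subset) (use p_in in auto)
    moreover have "(p has_real_derivative b - a) (at s within {0..1})"
      unfolding p_def by (auto intro!: derivative_eq_intros)
    ultimately have "((\<lambda>s. F (p s)) has_real_derivative F' (p s) * (b - a)) (at s within {0..1})"
      using DERIV_image_chain[of F _ p] by (simp add: o_def)
    then show ?thesis
      unfolding r_def by (auto intro!: derivative_eq_intros simp: algebra_simps)
  qed
  have q_deriv: "(q has_real_derivative L * \<bar>b - a\<bar>\<^sup>2 * s) (at s within A)" for s A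
    unfolding q_def by (auto intro!: derivative_eq_intros)
  have "norm (r 1 - r 0) \<le> q 1 - q 0"
  proof (rule differentiable_bound_general)
    show "continuous_on {0..1} r"
      unfolding continuous_on_eq_continuous_within using r_deriv DERIV_continuous by blast
    show "continuous_on {0..1} q"
      unfolding q_def by (intro continuous_intros)
    fix s :: real assume s: "0 < s" "s < 1"
    show "(r has_vector_derivative (F' (p s) - F' a) * (b - a)) (at s)"
      using r_deriv[of s] s at_within_Icc_at[of 0 s 1]
      by (simp add: has_real_derivative_iff_has_vector_derivative)
    show "(q has_vector_derivative L * \<bar>b - a\<bar>\<^sup>2 * s) (at s)"
      using q_deriv by (simp add: has_real_derivative_iff_has_vector_derivative)
    have "\<bar>F' (p s) - F' a\<bar> \<le> L * \<bar>p s - a\<bar>"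
      using lipschitz_onD[OF lip p_in \<open>a \<in> U\<close>, of s] s by (simp add: dist_real_def)
    also have "\<dots> = L * \<bar>b - a\<bar> * s"
      using s by (simp add: p_def abs_mult)
    finally have "\<bar>F' (p s) - F' a\<bar> * \<bar>b - a\<bar> \<le> L * \<bar>b - a\<bar> * s * \<bar>b - a\<bar>"
      by (rule mult_right_mono) simp
    then show "norm ((F' (p s) - F' a) * (b - a)) \<le> L * \<bar>b - a\<bar>\<^sup>2 * s"
      unfolding real_norm_def abs_mult power2_eq_square by (simp only: mult_ac)
  qed simp
  then show ?thesis
    by (simp add: r_def q_def p_def diff_diff_eq add.commute)
qed

lemma abs_deriv_ge_imp_abs_diff_ge:
  fixes h h' :: "real \<Rightarrow> real"
  assumes "is_interval U"
    and deriv: "\<And>t. t \<in> U \<Longrightarrow> (h has_real_derivative h' t) (at t within U)"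
    and lower: "\<And>t. t \<in> U \<Longrightarrow> \<bar>h' t\<bar> \<ge> \<gamma>" and "a \<in> U" "b \<in> U"
  shows "\<gamma> * \<bar>b - a\<bar> \<le> \<bar>h b - h a\<bar>"
  using \<open>a \<in> U\<close> \<open>b \<in> U\<close>
\<comment> \<open>Both sides are symmetric in \<open>a\<close> and \<open>b\<close>, and the case
  \<open>a = b\<close> is trivial.\<close>
proof (induction a b rule: linorder_less_wlog)
  case (less a b)
  then have sub: "{a..b} \<subseteq> U"
    using \<open>is_interval U\<close> by (meson atLeastAtMost_iff mem_is_interval_1_I subsetI)
  have "\<exists>t\<in>{a<..<b}. h b - h a = h' t * (b - a)"
  proof (rule mvt_simple[where f' = "\<lambda>t u. h' t * u", OF \<open>a < b\<close>])
    fix t assume "a \<le> t" "t \<le> b"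
    then have "(h has_real_derivative h' t) (at t within {a..b})"
      using DERIV_subset[OF deriv sub] sub by auto
    then show "(h has_derivative (\<lambda>u. h' t * u)) (at t within {a..b})"
      by (simp add: has_field_derivative_def)
  qed
  then obtain t where "t \<in> U" "h b - h a = h' t * (b - a)"
    using sub greaterThanLessThan_subseteq_atLeastAtMost_iff[of a b a b] by blast
  then show ?case
    using lower[of t] by (simp add: abs_mult mult_right_mono)
qed (simp_all add: abs_minus_commute)

text \<open>For odd \<open>k\<close>, step \<open>k - 1\<close> follows a tangent of
  \<open>f\<close> and step \<open>k\<close> one of \<open>g\<close>, which fixes where \<alpha> and
  \<beta> appear. The factors in parentheses contain \<beta> / (2 \<gamma>) and \<alpha> / (2
  \<gamma>) instead of the \<beta> / 2 and \<alpha> / 2 of the informal statement; like the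
  iteration, these ratios do not change when \<open>f\<close> and \<open>g\<close> are scaled by a
  common positive factor.\<close>

theorem proposition11:
  fixes U :: "real set" and f g f' g' :: "real \<Rightarrow> real"
    and \<alpha> \<beta> \<gamma> :: real and x :: "nat \<Rightarrow> real"
  assumes "is_interval U"
    and "\<And>t. t \<in> U \<Longrightarrow> (f has_real_derivative f' t) (at t within U)"
    and "\<And>t. t \<in> U \<Longrightarrow> (g has_real_derivative g' t) (at t within U)"
    and "\<alpha>-lipschitz_on U f'"
    and "\<beta>-lipschitz_on U g'"
    and "\<gamma> > 0"
    and "\<And>t. t \<in> U \<Longrightarrow> \<bar>f' t - g' t\<bar> \<ge> \<gamma>"
    and "alternating_iteration U f f' g g' x"
  shows "\<forall>k. odd k \<longrightarrow>
      \<bar>step_diff x k\<bar> * (1 - \<beta> / (2 * \<gamma>) * \<bar>step_diff x k\<bar>)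
        \<le> \<alpha> / (2 * \<gamma>) * \<bar>step_diff x (k - 1)\<bar>\<^sup>2 \<and>
      \<bar>step_diff x (k + 1)\<bar> * (1 - \<alpha> / (2 * \<gamma>) * \<bar>step_diff x (k + 1)\<bar>)
        \<le> \<beta> / (2 * \<gamma>) * \<bar>step_diff x k\<bar>\<^sup>2"
proof (intro allI impI)
  fix k :: nat
  assume "odd k"
  \<comment> \<open>Since \<open>k\<close> is odd, the natural-number difference
    \<open>k - 1\<close> is the true predecessor \<open>m\<close>, the start of a step along
    \<open>f\<close>.\<close>
  then obtain m where k: "k = m + 1" and "even m"
    by (auto elim: oddE)
  define h where "h t = f t - g t" for t
  have x_in: "x n \<in> U" for n
    using assms(8) by (simp add: alternating_iteration_def)
  have f_step: "f (x n) + f' (x n) * (x (n + 1) - x n) = g (x (n + 1))"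
    and g_step: "g (x (n + 1)) + g' (x (n + 1)) * (x (n + 2) - x (n + 1)) = f (x (n + 2))"
    if "even n" for n
    using assms(8) that by (auto simp: alternating_iteration_def)
  have h_f: "\<bar>h (x (n + 1))\<bar> \<le> \<alpha> / 2 * \<bar>step_diff x n\<bar>\<^sup>2" if "even n" for n
  proof -
    have "h (x (n + 1)) = f (x (n + 1)) - f (x n) - f' (x n) * (x (n + 1) - x n)"
      using f_step[OF that] unfolding h_def by linarith
    then show ?thesis
      using lipschitz_deriv_remainder_le[OF assms(1,2,4) x_in[of n] x_in[of "n + 1"]]
      by (simp only: step_diff_def)
  qed
  have h_g: "\<bar>h (x (n + 2))\<bar> \<le> \<beta> / 2 * \<bar>step_diff x (n + 1)\<bar>\<^sup>2" if "even n" for n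
  proof -
    have "- h (x (n + 2))
        = g (x (n + 2)) - g (x (n + 1)) - g' (x (n + 1)) * (x (n + 2) - x (n + 1))"
      using g_step[OF that] unfolding h_def by linarith
    moreover have "step_diff x (n + 1) = x (n + 2) - x (n + 1)"
      by (simp add: step_diff_def)
    ultimately show ?thesis
      using lipschitz_deriv_remainder_le[OF assms(1,3,5) x_in[of "n + 1"] x_in[of "n + 2"]]
      by (metis abs_minus_cancel)
  qed
  have h_diff: "\<gamma> * \<bar>step_diff x n\<bar> \<le> \<bar>h (x (n + 1))\<bar> + \<bar>h (x n)\<bar>" for n
  proof -
    have "(h has_real_derivative f' t - g' t) (at t within U)" if "t \<in> U" for t
      unfolding h_def using assms(2,3) that by (intro DERIV_diff)
    from abs_deriv_ge_imp_abs_diff_ge[OF assms(1) this assms(7) x_in[of n] x_in[of "n + 1"]]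
    show ?thesis by (simp add: step_diff_def)
  qed
  \<comment> \<open>Dividing by \<gamma> affects both quadratic terms, so 1/\<gamma> also enters the
    coefficient \<open>B / (2 * \<gamma>)\<close> on the left.\<close>
  have rescale: "d * (1 - B / (2 * \<gamma>) * d) \<le> A / (2 * \<gamma>) * e\<^sup>2"
    if "\<gamma> * d \<le> B / 2 * d\<^sup>2 + A / 2 * e\<^sup>2" for A B d e :: real
  proof -
    have "d * (1 - B / (2 * \<gamma>) * d) = (\<gamma> * d - B / 2 * d\<^sup>2) / \<gamma>"
      using \<open>\<gamma> > 0\<close> by (simp add: field_simps power2_eq_square)
    also have "\<dots> \<le> (A / 2 * e\<^sup>2) / \<gamma>"
      using that \<open>\<gamma> > 0\<close> by (intro divide_right_mono) auto
    finally show ?thesis by simp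
  qed
  have "\<gamma> * \<bar>step_diff x k\<bar> \<le> \<beta> / 2 * \<bar>step_diff x k\<bar>\<^sup>2 + \<alpha> / 2 * \<bar>step_diff x (k - 1)\<bar>\<^sup>2"
    using h_diff[of k] h_f[OF \<open>even m\<close>] h_g[OF \<open>even m\<close>] by (simp add: k)
  \<comment> \<open>Here the roles swap: step \<open>k + 1\<close> starts at the even index
    \<open>m + 2\<close>, so the value of \<open>h\<close> at its start is bounded by
    \<open>h_g\<close> and that at its end by \<open>h_f\<close>.\<close>
  moreover have "\<gamma> * \<bar>step_diff x (k + 1)\<bar>
      \<le> \<alpha> / 2 * \<bar>step_diff x (k + 1)\<bar>\<^sup>2 + \<beta> / 2 * \<bar>step_diff x k\<bar>\<^sup>2"
    using h_diff[of "k + 1"] h_f[of "m + 2"] h_g[OF \<open>even m\<close>] \<open>even m\<close> by (simp add: k)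
  ultimately show "\<bar>step_diff x k\<bar> * (1 - \<beta> / (2 * \<gamma>) * \<bar>step_diff x k\<bar>)
        \<le> \<alpha> / (2 * \<gamma>) * \<bar>step_diff x (k - 1)\<bar>\<^sup>2 \<and>
      \<bar>step_diff x (k + 1)\<bar> * (1 - \<alpha> / (2 * \<gamma>) * \<bar>step_diff x (k + 1)\<bar>)
        \<le> \<beta> / (2 * \<gamma>) * \<bar>step_diff x k\<bar>\<^sup>2"
    by (intro conjI rescale)
qed

end
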